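(* The sample complexity of learning discrete distributions over a known domain of size $k$ in total variation distance, to accuracy $\varepsilon$ and with error probability $\delta$, satisfies $$\Phi(\mathrm{d}_{\rm TV},k,\varepsilon,\delta) = \Theta\left(\frac{k+\log(1/\delta)}{\varepsilon^2}\right).$$
   Context: Let $[k]=\{1,\dots,k\}$ and let $\Delta([k])$ be the set of probability distributions on $[k]$. For $p,q\in\Delta([k])$, the total variation distance is $\mathrm{d}_{\rm TV}(p,q)=\sup_{S\subseteq[k]}(p(S)-q(S))=\frac12\sum_{i=1}^k|p(i)-q(i)|\in[0,1]$. For a distance measure $\mathrm{d}$, an accuracy $\varepsilon>0$ and an error probability $\delta\in(0,1]$, $\Phi(\mathrm{d},k,\varepsilon,\delta)$ denotes the sample complexity of learning discrete distributions over the known domain $[k]$. That is, it is the smallest integer $n$ for which there is a (possibly randomized) estimator which, given $n$ i.i.d. samples from an unknown $p\in\Delta([k])$, outputs $\hat p\in\Delta([k])$ such that, for every $p\in\Delta([k])$, $\Pr[\mathrm{d}(p,\hat p)\le\varepsilon]\ge 1-\delta$. Asymptotics are taken with regard to $k$ going to infinity, $\varepsilon$ going to $0$, and $\delta$ going to $0$ (in that order). Thus $\Phi=\Theta(g)$ means that there are absolute constants $0<c\le C$, $k_0$, $\varepsilon_0>0$, $\delta_0>0$ such that $c\,g\le\Phi\le C\,g$ for all $k\ge k_0$, $0<\varepsilon\le\varepsilon_0$, $0<\delta\le\delta_0$. *)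

theory Defs
  imports "HOL-Probability.Probability"
begin

text \<open>The simplex \<open>\<Delta>([k])\<close>, with \<open>[k] = {1..k}\<close>.\<close>

definition dists :: "nat \<Rightarrow> nat pmf set" where
  "dists k = {p. set_pmf p \<subseteq> {1..k}}"

text \<open>\<open>\<Delta>([k])\<close> as a measurable space: the Borel sigma-algebra it inherits as a subset of
  \<open>k\<close>-dimensional Euclidean space, pulled back along \<open>p \<mapsto> (p(1), \<dots>, p(k))\<close>.
  (The numerical measure carried by \<open>vimage_algebra\<close> is irrelevant.)\<close>

definition dist_space :: "nat \<Rightarrow> nat pmf measure" where
  "dist_space k =
     vimage_algebra (dists k) (\<lambda>p. \<lambda>i\<in>{1..k}. pmf p i) (\<Pi>\<^sub>M i\<in>{1..k}. borel)"

definition tv_dist :: "nat \<Rightarrow> nat pmf \<Rightarrow> nat pmf \<Rightarrow> real" where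
  "tv_dist k p q =
     (SUP S\<in>Pow {1..k}. measure_pmf.prob p S - measure_pmf.prob q S)"

text \<open>A randomized estimator is a Markov kernel: it maps the list of samples to a probability
  measure on \<open>\<Delta>([k])\<close>, the law of its output given these samples. Only its values on lists
  over \<open>[k]\<close> of the length of the sample matter; it is required to be defined on all lists
  merely for convenience.\<close>

definition rand_estimators :: "nat \<Rightarrow> (nat list \<Rightarrow> nat pmf measure) set" where
  "rand_estimators k = count_space UNIV \<rightarrow>\<^sub>M prob_algebra (dist_space k)"

text \<open>The law of the output of estimator \<open>A\<close> on \<open>n\<close> i.i.d. samples from \<open>p\<close>
  (\<open>\<bind>\<close> is the bind of the Giry monad).\<close>

definition output_law ::
    "(nat list \<Rightarrow> nat pmf measure) \<Rightarrow> nat \<Rightarrow> nat pmf \<Rightarrow> nat pmf measure" where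
  "output_law A n p = measure_pmf (replicate_pmf n p) \<bind> A"

definition learns ::
    "(nat pmf \<Rightarrow> nat pmf \<Rightarrow> real) \<Rightarrow> nat \<Rightarrow> real \<Rightarrow> real \<Rightarrow> nat
      \<Rightarrow> (nat list \<Rightarrow> nat pmf measure) \<Rightarrow> bool" where
  "learns d k \<epsilon> \<delta> n A \<longleftrightarrow>
     (\<forall>p\<in>dists k. measure (output_law A n p) {q \<in> dists k. d p q \<le> \<epsilon>} \<ge> 1 - \<delta>)"

text \<open>The infimum over an empty set is \<open>\<infinity>\<close>; otherwise it is the minimum, as \<open>enat\<close> is
  well-ordered.\<close>

definition sample_complexity ::
    "(nat pmf \<Rightarrow> nat pmf \<Rightarrow> real) \<Rightarrow> nat \<Rightarrow> real \<Rightarrow> real \<Rightarrow> enat" where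
  "sample_complexity d k \<epsilon> \<delta> =
     Inf {enat n | n. \<exists>A\<in>rand_estimators k. learns d k \<epsilon> \<delta> n A}"

text \<open>The two expressions for the total variation distance agree.\<close>

lemma tv_dist_half_L1:
  assumes p: "p \<in> dists k" and q: "q \<in> dists k"
  shows "tv_dist k p q = (\<Sum>i=1..k. \<bar>pmf p i - pmf q i\<bar>) / 2"
proof -
  let ?f = "\<lambda>i. pmf p i - pmf q i"
  let ?P = "{i\<in>{1..k}. ?f i \<ge> 0}" and ?N = "{i\<in>{1..k}. \<not> ?f i \<ge> 0}"
  have prob: "measure_pmf.prob p S - measure_pmf.prob q S = sum ?f S" if "S \<subseteq> {1..k}" for S
    using finite_subset[OF that] by (simp add: measure_measure_pmf_finite sum_subtractf)
  have split: "sum g {1..k} = sum g ?P + sum g ?N" for g :: "nat \<Rightarrow> real"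
    by (subst sum.union_disjoint[symmetric]) (auto intro!: sum.cong)
  have "sum ?f {1..k} = 0"
    using p q by (simp add: sum_subtractf dists_def sum_pmf_eq_1)
  then have N: "sum ?f ?N = - sum ?f ?P" using split[of ?f] by simp
  have "(\<Sum>i\<in>?P. \<bar>?f i\<bar>) = sum ?f ?P" by (intro sum.cong) auto
  moreover have "(\<Sum>i\<in>?N. \<bar>?f i\<bar>) = - sum ?f ?N"
    by (subst sum_negf[symmetric]) (intro sum.cong; auto)
  ultimately have "(\<Sum>i=1..k. \<bar>?f i\<bar>) = sum ?f ?P - sum ?f ?N"
    using split[of "\<lambda>i. \<bar>?f i\<bar>"] by simp
  then have half: "(\<Sum>i=1..k. \<bar>?f i\<bar>) / 2 = sum ?f ?P" using N by simp
  have le: "sum ?f S \<le> sum ?f ?P" if "S \<subseteq> {1..k}" for S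
  proof -
    have "finite S" using that finite_subset by blast
    then have "sum ?f S \<le> sum ?f (S \<inter> ?P)"
      using that by (subst sum.inter_restrict) (auto intro!: sum_mono)
    also have "\<dots> \<le> sum ?f ?P" by (intro sum_mono2) auto
    finally show ?thesis .
  qed
  have "tv_dist k p q = sum ?f ?P"
    unfolding tv_dist_def
    by (rule cSup_eq_maximum) (use prob le in \<open>auto intro!: image_eqI[where x = ?P]\<close>)
  with half show ?thesis by simp
qed

text \<open>The event whose probability is taken in \<open>learns\<close> is measurable for \<open>d = tv_dist k\<close>.\<close>

lemma space_dist_space: "space (dist_space k) = dists k"
  by (simp add: dist_space_def)

lemma tv_ball_in_sets:
  assumes "p \<in> dists k"
  shows "{q \<in> dists k. tv_dist k p q \<le> \<epsilon>} \<in> sets (dist_space k)"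
proof -
  have [measurable]: "(\<lambda>q. pmf q i) \<in> borel_measurable (dist_space k)" if "i \<in> {1..k}" for i
  proof -
    have "(\<lambda>q. \<lambda>i\<in>{1..k}. pmf q i) \<in> dist_space k \<rightarrow>\<^sub>M (\<Pi>\<^sub>M i\<in>{1..k}. borel)"
      unfolding dist_space_def by (intro measurable_vimage_algebra1) (auto simp: space_PiM)
    from measurable_compose[OF this measurable_component_singleton[OF that]] that
    show ?thesis by simp
  qed
  have "{q \<in> space (dist_space k). (\<Sum>i=1..k. \<bar>pmf p i - pmf q i\<bar>) / 2 \<le> \<epsilon>} \<in> sets (dist_space k)"
    by measurable
  also have "{q \<in> space (dist_space k). (\<Sum>i=1..k. \<bar>pmf p i - pmf q i\<bar>) / 2 \<le> \<epsilon>}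
      = {q \<in> dists k. tv_dist k p q \<le> \<epsilon>}"
    using assms by (auto simp: space_dist_space tv_dist_half_L1)
  finally show ?thesis .
qed

end

theory Submission
  imports Defs
begin

text \<open>Upper bound: the empirical distribution underestimates each of the \<open>2 ^ k\<close> events by more than \<open>\<epsilon>\<close>
  with probability at most \<open>exp (- 2 * n * \<epsilon>\<^sup>2)\<close> by Hoeffding's inequality, and the total variation
  distance is the largest of these errors.

  Lower bound: for \<open>T \<subseteq> {..<m}\<close>, tilt each pair of points of the uniform distribution on \<open>2 * m\<close>
  points by a factor \<open>1 \<plusminus> s\<close>, \<open>s = 16 * \<epsilon>\<close>, in a direction given by \<open>T\<close>. An output within \<open>\<epsilon>\<close> of the
  truth gets all but an eighth of the directions right, while Assouad's argument (via the Hellinger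
  affinity, which is multiplicative in the samples) shows that the average fraction \<open>\<eta>\<close> of wrong
  directions satisfies \<open>(1 - s\<^sup>2 / m) ^ (2 * n) \<le> 4 * \<eta>\<close>. With \<open>m = k div 2\<close> and \<open>\<eta>\<close> a small constant this
  gives \<open>n = \<Omega>(k / \<epsilon>\<^sup>2)\<close>; with \<open>m = 1\<close> and \<open>\<eta> = \<delta>\<close> it gives \<open>n = \<Omega>(ln (1 / \<delta>) / \<epsilon>\<^sup>2)\<close>.\<close>

section \<open>Samples\<close>

lemma map_replicate_pmf:
  "map_pmf (map f) (replicate_pmf n p) = replicate_pmf n (map_pmf f p)"
proof (induction n)
  case (Suc n)
  then show ?case
    unfolding replicate_pmf.simps
    by (simp add: map_bind_pmf bind_map_pmf flip: Suc)
qed simp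

lemma pmf_replicate_Suc_Cons:
  "pmf (replicate_pmf (Suc n) p) (x # xs) = pmf p x * pmf (replicate_pmf n p) xs"
proof -
  have "replicate_pmf (Suc n) p = map_pmf (\<lambda>(x, xs). x # xs) (pair_pmf p (replicate_pmf n p))"
    by (simp add: pair_pmf_def map_pmf_def bind_assoc_pmf bind_return_pmf)
  moreover have "inj (\<lambda>(x, xs). x # xs)" by (auto simp: inj_def)
  ultimately show ?thesis
    using pmf_map_inj'[of "\<lambda>(x, xs). x # xs" "pair_pmf p (replicate_pmf n p)" "(x, xs)"]
    by (simp add: pmf_pair)
qed

lemma map_pmf_mem_eq_bernoulli:
  "map_pmf (\<lambda>x. x \<in> S) p = bernoulli_pmf (measure_pmf.prob p S)"
proof (rule pmf_eqI)
  fix b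
  have "pmf (map_pmf (\<lambda>x. x \<in> S) p) b = measure_pmf.prob p (if b then S else - S)"
    by (auto simp: pmf_map intro!: arg_cong[where f = "measure_pmf.prob p"])
  then show "pmf (map_pmf (\<lambda>x. x \<in> S) p) b = pmf (bernoulli_pmf (measure_pmf.prob p S)) b"
    using measure_pmf.prob_compl[of S p] by (simp add: Compl_eq_Diff_UNIV)
qed

text \<open>Membership in \<open>S\<close> turns the samples into independent coin tosses, so
  Hoeffding's inequality for the binomial distribution applies to the empirical mass of any
  event.\<close>

lemma length_filter_replicate_pmf:
  "map_pmf (\<lambda>xs. length (filter (\<lambda>x. x \<in> S) xs)) (replicate_pmf n p)
     = binomial_pmf n (measure_pmf.prob p S)"
proof -
  have "binomial_pmf n (measure_pmf.prob p S)
      = map_pmf (length \<circ> filter id) (map_pmf (map (\<lambda>x. x \<in> S)) (replicate_pmf n p))"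
    by (simp add: binomial_pmf_altdef map_replicate_pmf map_pmf_mem_eq_bernoulli)
  also have "\<dots> = map_pmf (\<lambda>xs. length (filter (\<lambda>x. x \<in> S) xs)) (replicate_pmf n p)"
    by (simp add: pmf.map_comp o_def filter_map)
  finally show ?thesis ..
qed

section \<open>The empirical estimator\<close>

text \<open>The default point mass at \<open>1\<close> stands in for the empty list and for lists
  leaving the domain, so that every list yields an output in the simplex once
  \<open>1 \<le> k\<close>.\<close>

definition empirical :: "nat \<Rightarrow> nat list \<Rightarrow> nat pmf" where
  "empirical k xs =
     (if xs \<noteq> [] \<and> set xs \<subseteq> {1..k} then pmf_of_multiset (mset xs) else return_pmf 1)"

lemma empirical_in_dists: "1 \<le> k \<Longrightarrow> empirical k xs \<in> dists k"
  by (auto simp: empirical_def dists_def)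

lemma prob_empirical:
  assumes "finite S" "xs \<noteq> []" "set xs \<subseteq> {1..k}"
  shows "measure_pmf.prob (empirical k xs) S = real (length (filter (\<lambda>x. x \<in> S) xs)) / real (length xs)"
proof -
  \<comment> \<open>This additive form lets the sum over \<open>S\<close> split in the
    induction.\<close>
  have count: "count (mset (y # ys)) i = (if i = y then 1 else 0) + count (mset ys) i"
    for y i and ys :: "nat list"
    by simp
  have "(\<Sum>i\<in>S. count (mset xs) i) = length (filter (\<lambda>x. x \<in> S) xs)"
    using \<open>finite S\<close> by (induction xs) (simp_all add: count sum.distrib del: mset.simps)
  then show ?thesis
    using assms
    by (simp add: empirical_def measure_measure_pmf_finite flip: sum_divide_distrib of_nat_sum)
qed

text \<open>A function into the simplex acts as the kernel of its point masses. Measurability is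
  free because lists carry the discrete sigma-algebra, and the output law is the image of the sample
  law.\<close>

lemma deterministic_estimator:
  assumes "\<And>xs. f xs \<in> dists k"
  shows "(\<lambda>xs. return (dist_space k) (f xs)) \<in> rand_estimators k"
    and "B \<in> sets (dist_space k) \<Longrightarrow>
      measure (output_law (\<lambda>xs. return (dist_space k) (f xs)) n p) B
        = measure_pmf.prob (replicate_pmf n p) {xs. f xs \<in> B}"
proof -
  have "return (dist_space k) (f xs) \<in> space (prob_algebra (dist_space k))" for xs
    using assms by (simp add: space_prob_algebra prob_space_return space_dist_space)
  then show *: "(\<lambda>xs. return (dist_space k) (f xs)) \<in> rand_estimators k"
    by (simp add: rand_estimators_def)
  assume B: "B \<in> sets (dist_space k)"
  have "(\<lambda>xs. return (dist_space k) (f xs)) \<in> replicate_pmf n p \<rightarrow>\<^sub>M subprob_algebra (dist_space k)"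
    using measurable_prob_algebraD[OF *[unfolded rand_estimators_def]]
    by (simp cong: measurable_cong_sets)
  from measure_pmf.measure_bind[OF this B]
  have "measure (output_law (\<lambda>xs. return (dist_space k) (f xs)) n p) B
      = (\<integral>xs. indicator {xs. f xs \<in> B} xs \<partial>replicate_pmf n p)"
    using B by (simp add: output_law_def measure_return indicator_def)
  then show "measure (output_law (\<lambda>xs. return (dist_space k) (f xs)) n p) B
      = measure_pmf.prob (replicate_pmf n p) {xs. f xs \<in> B}" by simp
qed

lemma empirical_learns:
  assumes k: "1 \<le> k" and \<epsilon>: "0 \<le> \<epsilon>" and n: "0 < n" and \<delta>: "2 ^ k * exp (- 2 * real n * \<epsilon>\<^sup>2) \<le> \<delta>"
  shows "learns (tv_dist k) k \<epsilon> \<delta> n (\<lambda>xs. return (dist_space k) (empirical k xs))"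
  unfolding learns_def
proof
  fix p assume p: "p \<in> dists k"
  let ?R = "replicate_pmf n p"
  let ?G = "{q \<in> dists k. tv_dist k p q \<le> \<epsilon>}"
  let ?len = "\<lambda>S xs. length (filter (\<lambda>x. x \<in> S) xs)"
  \<comment> \<open>Only shortfalls of the empirical mass are tracked, since the supremum in
    \<open>tv_dist\<close> carries no absolute value.\<close>
  let ?B = "\<lambda>S. {xs. real (?len S xs) / real n \<le> measure_pmf.prob p S - \<epsilon>}"
  have "measure_pmf.prob ?R (- {xs. empirical k xs \<in> ?G}) \<le> measure_pmf.prob ?R (\<Union>S\<in>Pow {1..k}. ?B S)"
  \<comment> \<open>The inclusion is shown only on the support, where lists have length
    \<open>n\<close> and entries in the domain, so that \<open>prob_empirical\<close>
    applies.\<close>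
  proof (rule measure_pmf.finite_measure_mono_AE)
    have "xs \<in> (\<Union>S\<in>Pow {1..k}. ?B S)"
      if xs: "xs \<in> set_pmf ?R" and bad: "empirical k xs \<notin> ?G" for xs
    proof -
      have len: "length xs = n" and sub: "set xs \<subseteq> {1..k}"
        using xs p by (auto simp: set_replicate_pmf dists_def)
      have "\<epsilon> < tv_dist k p (empirical k xs)"
        using bad empirical_in_dists[OF k] by auto
      then obtain S where S: "S \<in> Pow {1..k}"
        and gt: "\<epsilon> < measure_pmf.prob p S - measure_pmf.prob (empirical k xs) S"
        unfolding tv_dist_def by (subst (asm) less_cSUP_iff) auto
      have "finite S" using S finite_subset by auto
      with gt S len sub n show ?thesis
        by (intro UN_I[OF S]) (auto simp: prob_empirical)
    qed
    then show "AE xs in ?R. xs \<in> - {xs. empirical k xs \<in> ?G} \<longrightarrow> xs \<in> (\<Union>S\<in>Pow {1..k}. ?B S)"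
      by (auto simp: AE_measure_pmf_iff)
  qed simp
  also have "\<dots> \<le> (\<Sum>S\<in>Pow {1..k}. measure_pmf.prob ?R (?B S))"
    by (rule measure_pmf.finite_measure_subadditive_finite) auto
  also have "\<dots> \<le> (\<Sum>S\<in>Pow {1..k}. exp (- 2 * real n * \<epsilon>\<^sup>2))"
  proof (rule sum_mono)
    fix S
    interpret binomial_distribution n "measure_pmf.prob p S" by unfold_locales simp
    have "measure_pmf.prob ?R (?B S)
        = measure_pmf.prob (map_pmf (?len S) ?R) {x. real x / real n \<le> measure_pmf.prob p S - \<epsilon>}"
      by simp
    \<comment> \<open>\<open>prob_le'\<close> is Hoeffding's bound for the lower tail.\<close>
    also have "\<dots> \<le> exp (- 2 * real n * \<epsilon>\<^sup>2)"
      unfolding length_filter_replicate_pmf using prob_le'[of \<epsilon>] n \<epsilon> by simp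
    finally show "measure_pmf.prob ?R (?B S) \<le> exp (- 2 * real n * \<epsilon>\<^sup>2)" .
  qed
  also have "\<dots> \<le> \<delta>" using \<delta> by (simp add: card_Pow)
  finally have "1 - \<delta> \<le> measure_pmf.prob ?R {xs. empirical k xs \<in> ?G}"
    using measure_pmf.prob_compl[of "{xs. empirical k xs \<in> ?G}" ?R]
    by (simp add: Compl_eq_Diff_UNIV)
  also have "\<dots> = measure (output_law (\<lambda>xs. return (dist_space k) (empirical k xs)) n p) ?G"
    using empirical_in_dists[OF k] tv_ball_in_sets[OF p]
    by (intro deterministic_estimator(2)[symmetric])
  finally show "1 - \<delta> \<le> measure (output_law (\<lambda>xs. return (dist_space k) (empirical k xs)) n p) ?G" .
qed

lemma sample_complexity_upper:
  assumes k: "1 \<le> k" and \<epsilon>: "0 < \<epsilon>" "\<epsilon> \<le> 1" and \<delta>: "0 < \<delta>" "\<delta> \<le> 1"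
  shows "ereal_of_enat (sample_complexity (tv_dist k) k \<epsilon> \<delta>)
           \<le> ereal (2 * ((real k + ln (1 / \<delta>)) / \<epsilon>\<^sup>2))"
proof -
  \<comment> \<open>The real solution of
    \<open>2 ^ k * exp (- 2 * x * \<epsilon>\<^sup>2) = \<delta>\<close>, rounded up to the sample
    size \<open>n\<close>.\<close>
  define x where "x = (real k * ln 2 + ln (1 / \<delta>)) / (2 * \<epsilon>\<^sup>2)"
  define n where "n = nat \<lceil>x\<rceil>"
  have L: "0 \<le> ln (1 / \<delta>)" using \<delta> by simp
  have ln2: "0 < ln (2::real)" "ln (2::real) \<le> 1" using ln_le_minus_one[of 2] by auto
  have x: "0 < x"
    unfolding x_def using k ln2 L \<epsilon> by (intro divide_pos_pos add_pos_nonneg mult_pos_pos) auto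
  have nx: "x \<le> real n" "real n \<le> x + 1" and n: "0 < n"
    unfolding n_def using x by linarith+
  have "2 ^ k * exp (- 2 * real n * \<epsilon>\<^sup>2) = exp (real k * ln 2 - real n * (2 * \<epsilon>\<^sup>2))"
    by (simp add: exp_diff exp_minus exp_of_nat_mult divide_simps mult_ac)
  also have "\<dots> \<le> exp (ln \<delta>)"
  proof -
    have "x * (2 * \<epsilon>\<^sup>2) = real k * ln 2 + ln (1 / \<delta>)" unfolding x_def using \<epsilon> by simp
    moreover have "x * (2 * \<epsilon>\<^sup>2) \<le> real n * (2 * \<epsilon>\<^sup>2)" using nx by (intro mult_right_mono) auto
    ultimately show ?thesis
      using \<delta> by (subst exp_le_cancel_iff) (simp add: ln_div)
  qed
  finally have "learns (tv_dist k) k \<epsilon> \<delta> n (\<lambda>xs. return (dist_space k) (empirical k xs))"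
    using k \<epsilon> \<delta> n by (intro empirical_learns) auto
  moreover have "(\<lambda>xs. return (dist_space k) (empirical k xs)) \<in> rand_estimators k"
    using empirical_in_dists[OF k] by (rule deterministic_estimator(1))
  ultimately have "sample_complexity (tv_dist k) k \<epsilon> \<delta> \<le> enat n"
    unfolding sample_complexity_def by (intro Inf_lower) auto
  then have "ereal_of_enat (sample_complexity (tv_dist k) k \<epsilon> \<delta>) \<le> ereal_of_enat (enat n)"
    by (simp only: ereal_of_enat_le_iff)
  also have "\<dots> = ereal (real n)" by simp
  \<comment> \<open>Rounding up costs at most 1, which a second copy of the main term absorbs
    because \<open>1 \<le> k\<close> and \<open>\<epsilon> \<le> 1\<close>.\<close>
  also have "real n \<le> 2 * ((real k + ln (1 / \<delta>)) / \<epsilon>\<^sup>2)"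
  proof -
    have e2: "0 < \<epsilon>\<^sup>2" "\<epsilon>\<^sup>2 \<le> 1" using \<epsilon> by (auto simp: power_le_one)
    have "x \<le> (real k + ln (1 / \<delta>)) / \<epsilon>\<^sup>2"
      unfolding x_def using e2 L ln2 mult_left_mono[OF ln2(2), of "real k"] k
      by (intro frac_le) auto
    moreover have "1 \<le> (real k + ln (1 / \<delta>)) / \<epsilon>\<^sup>2"
      using e2 L k by (simp add: le_divide_eq)
    ultimately show ?thesis using nx by linarith
  qed
  finally show ?thesis by simp
qed

section \<open>Testing two hypotheses\<close>

lemma sum_lists_Suc:
  "finite S \<Longrightarrow> (\<Sum>xs\<in>{xs. set xs \<subseteq> S \<and> length xs = Suc n}. f xs)
     = (\<Sum>x\<in>S. \<Sum>xs\<in>{xs. set xs \<subseteq> S \<and> length xs = n}. f (x # xs))"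
proof -
  assume S: "finite S"
  have "{xs. set xs \<subseteq> S \<and> length xs = Suc n}
      = (\<lambda>(x, xs). x # xs) ` (S \<times> {xs. set xs \<subseteq> S \<and> length xs = n})"
    by (auto simp: length_Suc_conv image_iff)
  moreover have "inj_on (\<lambda>(x, xs). x # xs) (S \<times> {xs. set xs \<subseteq> S \<and> length xs = n})"
    by (auto simp: inj_on_def)
  ultimately show ?thesis
    by (simp add: sum.reindex sum.cartesian_product case_prod_unfold)
qed

text \<open>The Hellinger affinity is multiplicative: the likelihood of a list is a product over its
  entries, so the sum over lists factorises.\<close>

lemma affinity_replicate_pmf:
  assumes "finite S"
  shows "(\<Sum>xs\<in>{xs. set xs \<subseteq> S \<and> length xs = n}.
            sqrt (pmf (replicate_pmf n p) xs * pmf (replicate_pmf n q) xs))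
           = (\<Sum>x\<in>S. sqrt (pmf p x * pmf q x)) ^ n"
proof (induction n)
  case 0
  have "{xs. set xs \<subseteq> S \<and> length xs = 0} = {[]}" by auto
  then show ?case by simp
next
  case (Suc n)
  show ?case
    unfolding sum_lists_Suc[OF assms] pmf_replicate_Suc_Cons power_Suc Suc[symmetric] sum_product
    by (simp add: real_sqrt_mult mult_ac)
qed

text \<open>Le Cam's bound for a randomized test, where \<open>f\<close> and \<open>g\<close> are
  its error probabilities given the sample. The total error is at least the sum of the pointwise
  smaller likelihoods, and this is at least half the squared affinity.\<close>

lemma two_point_testing:
  assumes S: "finite S" "set_pmf p \<subseteq> S" "set_pmf q \<subseteq> S"
    and f: "\<And>xs. 0 \<le> f xs" "\<And>xs. 0 \<le> g xs" "\<And>xs. 1 \<le> f xs + g xs"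
  shows "(\<Sum>x\<in>S. sqrt (pmf p x * pmf q x)) ^ (2 * n)
    \<le> 2 * (measure_pmf.expectation (replicate_pmf n p) f + measure_pmf.expectation (replicate_pmf n q) g)"
proof -
  let ?L = "{xs. set xs \<subseteq> S \<and> length xs = n}"
  let ?P = "pmf (replicate_pmf n p)" and ?Q = "pmf (replicate_pmf n q)"
  let ?mi = "\<lambda>xs. min (?P xs) (?Q xs)" and ?ma = "\<lambda>xs. max (?P xs) (?Q xs)"
  have fin: "finite ?L" using S(1) by (rule finite_lists_length_eq)
  have suppP: "set_pmf (replicate_pmf n p) \<subseteq> ?L" and suppQ: "set_pmf (replicate_pmf n q) \<subseteq> ?L"
    using S by (auto simp: set_replicate_pmf)
  have P1: "sum ?P ?L = 1" and Q1: "sum ?Q ?L = 1"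
    using fin suppP suppQ by (auto intro: sum_pmf_eq_1)
  have "(\<Sum>x\<in>S. sqrt (pmf p x * pmf q x)) ^ (2 * n) = (\<Sum>xs\<in>?L. sqrt (?P xs * ?Q xs))\<^sup>2"
    unfolding affinity_replicate_pmf[OF S(1)] by (simp add: power_mult mult.commute)
  also have "\<dots> = (\<Sum>xs\<in>?L. sqrt (?mi xs) * sqrt (?ma xs))\<^sup>2"
    by (intro arg_cong[where f = "\<lambda>x. x\<^sup>2"] sum.cong)
       (auto simp: min_def max_def mult.commute simp flip: real_sqrt_mult)
  \<comment> \<open>Splitting into minimum and maximum makes the second factor at most 2, the first the testing error.\<close>
  also have "\<dots> \<le> (\<Sum>xs\<in>?L. (sqrt (?mi xs))\<^sup>2) * (\<Sum>xs\<in>?L. (sqrt (?ma xs))\<^sup>2)"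
    by (rule Cauchy_Schwarz_ineq_sum)
  also have "\<dots> = sum ?mi ?L * sum ?ma ?L" by (simp add: le_max_iff_disj)
  also have "\<dots> \<le> sum ?mi ?L * (sum ?P ?L + sum ?Q ?L)"
    unfolding sum.distrib[symmetric] by (intro mult_left_mono sum_mono sum_nonneg) auto
  also have "\<dots> = 2 * sum ?mi ?L" by (simp add: P1 Q1)
  also have "sum ?mi ?L \<le> (\<Sum>xs\<in>?L. f xs * ?P xs + g xs * ?Q xs)"
  proof (rule sum_mono)
    fix xs
    have "?mi xs \<le> (f xs + g xs) * ?mi xs"
      using mult_right_mono[OF f(3)[of xs], of "?mi xs"] by simp
    also have "\<dots> \<le> f xs * ?P xs + g xs * ?Q xs"
      unfolding distrib_right using f by (intro add_mono mult_left_mono) auto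
    finally show "?mi xs \<le> f xs * ?P xs + g xs * ?Q xs" .
  qed
  also have "\<dots> = measure_pmf.expectation (replicate_pmf n p) f
      + measure_pmf.expectation (replicate_pmf n q) g"
    using suppP suppQ fin
    by (subst (1 2) integral_measure_pmf_real[where A = ?L])
       (auto simp: sum.distrib set_pmf_eq)
  finally show ?thesis by simp
qed

section \<open>Assouad's hypercube\<close>

text \<open>The pairs are \<open>{2 * j + 1, 2 * j + 2}\<close> for \<open>j < m\<close>; the first point is the heavier one iff \<open>j \<in> T\<close>.\<close>

definition tilt :: "nat set \<Rightarrow> nat \<Rightarrow> real" where
  "tilt T x = (if ((x - 1) div 2 \<in> T) = odd x then 1 else - 1)"

definition cube_pmf :: "nat \<Rightarrow> real \<Rightarrow> nat set \<Rightarrow> nat pmf" where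
  "cube_pmf m s T =
     embed_pmf (\<lambda>x. if x \<in> {1..2 * m} then (1 + s * tilt T x) / (2 * real m) else 0)"

lemma tilt_pair:
  "tilt T (2 * j + 1) = (if j \<in> T then 1 else - 1)"
  "tilt T (2 * j + 2) = (if j \<in> T then - 1 else 1)"
  by (auto simp: tilt_def)

lemma sum_pairs:
  fixes f :: "nat \<Rightarrow> 'a :: comm_monoid_add"
  shows "(\<Sum>x\<in>{1..2 * m}. f x) = (\<Sum>j<m. f (2 * j + 1) + f (2 * j + 2))"
  by (induction m) (simp_all add: add.assoc)

context
  fixes m :: nat and s :: real
  assumes m: "0 < m" and s: "0 \<le> s" "s \<le> 1"
begin

lemma pmf_cube_pmf:
  "pmf (cube_pmf m s T) x = (if x \<in> {1..2 * m} then (1 + s * tilt T x) / (2 * real m) else 0)"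
  unfolding cube_pmf_def
proof (rule pmf_embed_pmf)
  let ?f = "\<lambda>x. if x \<in> {1..2 * m} then (1 + s * tilt T x) / (2 * real m) else 0"
  show nonneg: "0 \<le> ?f x" for x using s by (simp add: tilt_def)
  have "(\<integral>\<^sup>+ x. ennreal (?f x) \<partial>count_space UNIV) = (\<Sum>x\<in>{1..2 * m}. ennreal (?f x))"
    by (rule nn_integral_count_space') auto
  also have "\<dots> = ennreal (\<Sum>x\<in>{1..2 * m}. ?f x)" by (intro sum_ennreal nonneg)
  \<comment> \<open>The opposite tilts within a pair cancel, so every pair has mass
    \<open>1 / m\<close>.\<close>
  also have "(\<Sum>x\<in>{1..2 * m}. ?f x) = (\<Sum>j<m. 1 / real m)"
    unfolding sum_pairs
  proof (rule sum.cong)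
    fix j assume "j \<in> {..<m}"
    moreover have "(1 + s * tilt T (2 * j + 1)) / (2 * real m) + (1 + s * tilt T (2 * j + 2)) / (2 * real m)
        = 1 / real m"
      unfolding tilt_pair by (simp flip: add_divide_distrib)
    ultimately show "?f (2 * j + 1) + ?f (2 * j + 2) = 1 / real m" by simp
  qed simp
  finally show "(\<integral>\<^sup>+ x. ennreal (?f x) \<partial>count_space UNIV) = 1" using m by simp
qed

lemma set_pmf_cube_pmf: "set_pmf (cube_pmf m s T) \<subseteq> {1..2 * m}"
  by (auto simp: set_pmf_eq pmf_cube_pmf split: if_splits)

lemma cube_pmf_in_dists: "2 * m \<le> k \<Longrightarrow> cube_pmf m s T \<in> dists k"
  using set_pmf_cube_pmf[of T] by (fastforce simp: dists_def)

text \<open>Both distributions agree on each pair other than \<open>j\<close>, which therefore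
  contributes its full mass \<open>1 / m\<close>. On pair \<open>j\<close> the tilts are opposite,
  and the contribution is \<open>sqrt (1 - s\<^sup>2) / m\<close>.\<close>

lemma affinity_cube_pmf_ge:
  assumes j: "j < m" and T': "\<And>i. i \<noteq> j \<Longrightarrow> i \<in> T' \<longleftrightarrow> i \<in> T" "j \<in> T' \<longleftrightarrow> j \<notin> T"
  shows "1 - s\<^sup>2 / real m
    \<le> (\<Sum>x\<in>{1..2 * m}. sqrt (pmf (cube_pmf m s T) x * pmf (cube_pmf m s T') x))"
proof -
  let ?g = "\<lambda>x. sqrt (pmf (cube_pmf m s T) x * pmf (cube_pmf m s T') x)"
  have s2: "0 \<le> s\<^sup>2" "s\<^sup>2 \<le> 1" using s by (auto simp: power_le_one)
  have sqrt_ge: "1 - s\<^sup>2 \<le> sqrt (1 - s\<^sup>2)"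
  proof (rule real_le_rsqrt)
    show "(1 - s\<^sup>2)\<^sup>2 \<le> 1 - s\<^sup>2"
      unfolding power2_eq_square[of "1 - s\<^sup>2"] using s2 by (intro mult_left_le) auto
  qed
  have pair: "(1 - (if i = j then s\<^sup>2 else 0)) / real m \<le> ?g (2 * i + 1) + ?g (2 * i + 2)" if i: "i < m" for i
  proof (cases "i = j")
    case True
    have "pmf (cube_pmf m s T) x * pmf (cube_pmf m s T') x = (1 - s\<^sup>2) / (2 * real m)\<^sup>2"
      if "x = 2 * i + 1 \<or> x = 2 * i + 2" for x
      using that
    proof
      assume "x = 2 * i + 1"
      then show ?thesis using i T' True unfolding pmf_cube_pmf
        by (auto simp only: tilt_pair) (auto simp: power2_eq_square algebra_simps)
    next
      assume "x = 2 * i + 2"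
      then show ?thesis using i T' True unfolding pmf_cube_pmf
        by (auto simp only: tilt_pair) (auto simp: power2_eq_square algebra_simps)
    qed
    note prod = this
    have "?g x = sqrt (1 - s\<^sup>2) / (2 * real m)" if "x = 2 * i + 1 \<or> x = 2 * i + 2" for x
      by (simp only: prod[OF that] real_sqrt_divide real_sqrt_abs)
    then have "?g (2 * i + 1) = sqrt (1 - s\<^sup>2) / (2 * real m)" "?g (2 * i + 2) = sqrt (1 - s\<^sup>2) / (2 * real m)"
      by blast+
    then show ?thesis using True sqrt_ge by (simp add: divide_right_mono add_divide_distrib[symmetric])
  next
    case False
    then have "tilt T' (2 * i + 1) = tilt T (2 * i + 1)" "tilt T' (2 * i + 2) = tilt T (2 * i + 2)"
      unfolding tilt_pair using T' by simp_all
    then have eq: "pmf (cube_pmf m s T') (2 * i + 1) = pmf (cube_pmf m s T) (2 * i + 1)"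
      "pmf (cube_pmf m s T') (2 * i + 2) = pmf (cube_pmf m s T) (2 * i + 2)"
      by (simp_all add: pmf_cube_pmf)
    have "?g (2 * i + 1) = pmf (cube_pmf m s T) (2 * i + 1)"
      "?g (2 * i + 2) = pmf (cube_pmf m s T) (2 * i + 2)"
      unfolding eq by simp_all
    moreover have "pmf (cube_pmf m s T) (2 * i + 1) + pmf (cube_pmf m s T) (2 * i + 2) = 1 / real m"
      using i unfolding pmf_cube_pmf tilt_pair by (simp flip: add_divide_distrib)
    ultimately show ?thesis using False by simp
  qed
  have "1 - s\<^sup>2 / real m = (\<Sum>i<m. (1 - (if i = j then s\<^sup>2 else 0)) / real m)"
    using j m by (simp add: sum_subtractf diff_divide_distrib flip: sum_divide_distrib)
  also have "\<dots> \<le> (\<Sum>i<m. ?g (2 * i + 1) + ?g (2 * i + 2))"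
    using pair by (intro sum_mono) auto
  finally show ?thesis by (simp only: sum_pairs)
qed

end

section \<open>Decoding directions from an output\<close>

text \<open>The outputs from which \<open>j \<in> T\<close> is decoded wrongly; ties are decoded as \<open>j \<in> T\<close>.\<close>

definition misread :: "nat \<Rightarrow> nat set \<Rightarrow> nat \<Rightarrow> nat pmf set" where
  "misread k T j = {q \<in> dists k. (pmf q (2 * j + 2) \<le> pmf q (2 * j + 1)) \<noteq> (j \<in> T)}"

lemma measurable_pmf_dist_space:
  assumes "i \<in> {1..k}"
  shows "(\<lambda>q. pmf q i) \<in> borel_measurable (dist_space k)"
proof -
  have "(\<lambda>q. \<lambda>i\<in>{1..k}. pmf q i) \<in> dist_space k \<rightarrow>\<^sub>M (\<Pi>\<^sub>M i\<in>{1..k}. borel)"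
    unfolding dist_space_def by (intro measurable_vimage_algebra1) (auto simp: space_PiM)
  from measurable_compose[OF this measurable_component_singleton[OF assms]] assms
  show ?thesis by simp
qed

lemma misread_in_sets:
  assumes "2 * j + 2 \<le> k"
  shows "misread k T j \<in> sets (dist_space k)"
proof -
  have [measurable]: "(\<lambda>q. pmf q (2 * j + 1)) \<in> borel_measurable (dist_space k)"
    "(\<lambda>q. pmf q (2 * j + 2)) \<in> borel_measurable (dist_space k)"
    using assms by (auto intro!: measurable_pmf_dist_space)
  have "{q \<in> space (dist_space k). (pmf q (2 * j + 2) \<le> pmf q (2 * j + 1)) \<noteq> (j \<in> T)}
      \<in> sets (dist_space k)"
    by measurable
  then show ?thesis by (simp add: misread_def space_dist_space)
qed

text \<open>On a misread pair the two masses differ by \<open>s / m\<close> in the true direction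
  under the cube distribution, but not in that direction under \<open>q\<close>. By the triangle
  inequality the pair adds at least \<open>s / m\<close> to the L1 distance, which is twice the
  total variation.\<close>

lemma tv_dist_cube_pmf_ge:
  assumes m: "0 < m" and s: "0 \<le> s" "s \<le> 1" and k: "2 * m \<le> k" and q: "q \<in> dists k"
  shows "s / (2 * real m) * (\<Sum>j<m. indicator (misread k T j) q) \<le> tv_dist k (cube_pmf m s T) q"
proof -
  let ?p = "cube_pmf m s T"
  let ?d = "\<lambda>x. \<bar>pmf ?p x - pmf q x\<bar>"
  have "s / real m * indicator (misread k T j) q \<le> ?d (2 * j + 1) + ?d (2 * j + 2)"
    if j: "j < m" for j
  proof -
    have "pmf ?p (2 * j + 1) - pmf ?p (2 * j + 2) = (if j \<in> T then s / real m else - (s / real m))"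
      using j m unfolding pmf_cube_pmf[OF m s] tilt_pair by (auto simp: field_simps)
    then show ?thesis using s m
      by (auto simp: indicator_def misread_def split: if_splits)
  qed
  then have "(\<Sum>j<m. s / real m * indicator (misread k T j) q) \<le> (\<Sum>x\<in>{1..2 * m}. ?d x)"
    unfolding sum_pairs by (intro sum_mono) auto
  also have "\<dots> \<le> (\<Sum>x=1..k. ?d x)" using k by (intro sum_mono2) auto
  also have "\<dots> = 2 * tv_dist k ?p q"
    using cube_pmf_in_dists[OF m s k] q by (simp add: tv_dist_half_L1)
  finally have "s / real m * (\<Sum>j<m. indicator (misread k T j) q) \<le> 2 * tv_dist k ?p q"
    by (simp only: sum_distrib_left)
  moreover have "s / (2 * real m) * y \<le> t" if "s / real m * y \<le> 2 * t" for y t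
    using that m by (simp add: field_simps)
  ultimately show ?thesis by blast
qed

section \<open>Errors of an arbitrary estimator on the cube\<close>

context
  fixes A :: "nat list \<Rightarrow> nat pmf measure" and k n :: nat
  assumes A: "A \<in> rand_estimators k"
begin

lemma estimator_measurable: "A \<in> replicate_pmf n p \<rightarrow>\<^sub>M subprob_algebra (dist_space k)"
  using measurable_prob_algebraD[OF A[unfolded rand_estimators_def]]
  by (simp cong: measurable_cong_sets)

lemma estimator_prob_space: "prob_space (A xs)" "sets (A xs) = sets (dist_space k)"
  using measurable_space[OF A[unfolded rand_estimators_def], of xs] by (auto simp: space_prob_algebra)

lemma measure_output_law:
  "B \<in> sets (dist_space k) \<Longrightarrow>
     measure (output_law A n p) B = measure_pmf.expectation (replicate_pmf n p) (\<lambda>xs. measure (A xs) B)"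
  unfolding output_law_def by (rule measure_pmf.measure_bind[OF estimator_measurable])

lemma output_law_prob_space:
  "prob_space (output_law A n p)" "sets (output_law A n p) = sets (dist_space k)"
proof -
  have "measure_pmf (replicate_pmf n p) \<in> space (prob_algebra (count_space UNIV))"
    by (simp add: space_prob_algebra measure_pmf.prob_space_axioms)
  from prob_space_bind'[OF this A[unfolded rand_estimators_def]]
    sets_bind'[OF this A[unfolded rand_estimators_def]]
  show "prob_space (output_law A n p)" "sets (output_law A n p) = sets (dist_space k)"
    by (simp_all add: output_law_def)
qed

text \<open>Decoding at \<open>j\<close> is a randomized test of \<open>T\<close> against
  \<open>T'\<close>. The two misread sets are complementary in the simplex, so its conditional error
  probabilities add up to 1.\<close>

lemma misread_two_point:
  assumes m: "0 < m" and s: "0 \<le> s" "s \<le> 1" and k: "2 * m \<le> k" and j: "j < m"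
    and T': "\<And>i. i \<noteq> j \<Longrightarrow> i \<in> T' \<longleftrightarrow> i \<in> T" "j \<in> T' \<longleftrightarrow> j \<notin> T"
  shows "(1 - s\<^sup>2 / real m) ^ (2 * n)
    \<le> 2 * (measure (output_law A n (cube_pmf m s T)) (misread k T j)
         + measure (output_law A n (cube_pmf m s T')) (misread k T' j))"
proof -
  have sets: "misread k T j \<in> sets (dist_space k)" "misread k T' j \<in> sets (dist_space k)"
    using j k by (auto intro!: misread_in_sets)
  have "misread k T' j = dists k - misread k T j" using T' by (auto simp: misread_def)
  then have "measure (A xs) (misread k T j) + measure (A xs) (misread k T' j) = 1" for xs
    using prob_space.prob_compl[OF estimator_prob_space(1), of "misread k T j" xs]
      sets sets_eq_imp_space_eq[OF estimator_prob_space(2)]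
    by (simp add: estimator_prob_space space_dist_space)
  note sum1 = this
  have "s\<^sup>2 \<le> 1" using s by (simp add: power_le_one)
  then have "0 \<le> 1 - s\<^sup>2 / real m" using m by (simp add: field_simps)
  with affinity_cube_pmf_ge[OF m s j T']
  have "(1 - s\<^sup>2 / real m) ^ (2 * n)
    \<le> (\<Sum>x\<in>{1..2 * m}. sqrt (pmf (cube_pmf m s T) x * pmf (cube_pmf m s T') x)) ^ (2 * n)"
    by (intro power_mono) auto
  also have "\<dots> \<le> 2 * (measure_pmf.expectation (replicate_pmf n (cube_pmf m s T)) (\<lambda>xs. measure (A xs) (misread k T j))
      + measure_pmf.expectation (replicate_pmf n (cube_pmf m s T')) (\<lambda>xs. measure (A xs) (misread k T' j)))"
    using set_pmf_cube_pmf[OF m s] sum1 by (intro two_point_testing) auto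
  finally show ?thesis using sets by (simp add: measure_output_law)
qed

text \<open>Averaging over the cube: \<open>T\<close> and \<open>T\<close> with the membership of \<open>j\<close> flipped cannot both be decoded
  well at \<open>j\<close>.\<close>

lemma assouad:
  assumes m: "0 < m" and s: "0 \<le> s" "s \<le> 1" and k: "2 * m \<le> k"
    and err: "\<And>T. (\<Sum>j<m. measure (output_law A n (cube_pmf m s T)) (misread k T j)) \<le> \<eta> * real m"
  shows "(1 - s\<^sup>2 / real m) ^ (2 * n) \<le> 4 * \<eta>"
proof -
  let ?B = "(1 - s\<^sup>2 / real m) ^ (2 * n)"
  let ?a = "\<lambda>T j. measure (output_law A n (cube_pmf m s T)) (misread k T j)"
  let ?flip = "\<lambda>j T. if j \<in> T then T - {j} else insert j T"
  let ?Q = "Pow {..<m}"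
  have half: "real (card ?Q) * ?B \<le> 4 * (\<Sum>T\<in>?Q. ?a T j)" if j: "j < m" for j
  proof -
    \<comment> \<open>Flipping is an involution of the cube, so both error terms have the same sum
      over it; this doubles the factor 2 to 4.\<close>
    have "bij_betw (?flip j) ?Q ?Q"
      using j by (intro bij_betw_byWitness[where f' = "?flip j"]) auto
    then have flip: "(\<Sum>T\<in>?Q. ?a (?flip j T) j) = (\<Sum>T\<in>?Q. ?a T j)"
      by (rule sum.reindex_bij_betw)
    have "real (card ?Q) * ?B = (\<Sum>T\<in>?Q. ?B)" by simp
    also have "\<dots> \<le> (\<Sum>T\<in>?Q. 2 * (?a T j + ?a (?flip j T) j))"
      by (intro sum_mono misread_two_point[OF m s k j]) auto
    also have "\<dots> = 4 * (\<Sum>T\<in>?Q. ?a T j)"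
      unfolding sum_distrib_left[symmetric] sum.distrib flip by simp
    finally show ?thesis .
  qed
  have "real m * (real (card ?Q) * ?B) = (\<Sum>j<m. real (card ?Q) * ?B)" by simp
  also have "\<dots> \<le> (\<Sum>j<m. 4 * (\<Sum>T\<in>?Q. ?a T j))" using half by (intro sum_mono) auto
  also have "\<dots> = 4 * (\<Sum>T\<in>?Q. \<Sum>j<m. ?a T j)"
    unfolding sum_distrib_left[symmetric] by (subst sum.swap) simp
  also have "\<dots> \<le> 4 * (\<Sum>T\<in>?Q. \<eta> * real m)" using err by (intro mult_left_mono sum_mono) auto
  also have "\<dots> = real m * (real (card ?Q) * (4 * \<eta>))" by simp
  finally have "real m * (real (card ?Q) * ?B) \<le> real m * (real (card ?Q) * (4 * \<eta>))" .
  moreover have "0 < real (card ?Q)" by (simp add: card_Pow)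
  ultimately show ?thesis using m by simp
qed

text \<open>An output within \<open>\<epsilon>\<close> has at most \<open>b\<close> misreadings; any
  other output has at most \<open>m\<close>, and occurs with probability at most
  \<open>\<delta>\<close>. Quantifying \<open>b'\<close> over natural numbers allows
  \<open>b = 0\<close> when \<open>m = 1\<close>.\<close>

lemma learner_misreads_few:
  assumes m: "0 < m" and s: "0 < s" "s \<le> 1" and k: "2 * m \<le> k"
    and learns: "learns (tv_dist k) k \<epsilon> \<delta> n A"
    and b: "0 \<le> b" and b': "\<And>l. l \<le> m \<Longrightarrow> s / (2 * real m) * real l \<le> \<epsilon> \<Longrightarrow> real l \<le> b"
  shows "(\<Sum>j<m. measure (output_law A n (cube_pmf m s T)) (misread k T j)) \<le> b + \<delta> * real m"
proof -
  let ?p = "cube_pmf m s T"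
  let ?M = "output_law A n ?p"
  let ?G = "{q \<in> dists k. tv_dist k ?p q \<le> \<epsilon>}"
  let ?H = "\<lambda>q. \<Sum>j<m. indicator (misread k T j) q :: real"
  interpret M: prob_space ?M by (rule output_law_prob_space)
  have p: "?p \<in> dists k" using m s k by (intro cube_pmf_in_dists) auto
  have space: "space ?M = dists k"
    using sets_eq_imp_space_eq[OF output_law_prob_space(2)] by (simp add: space_dist_space)
  have G: "?G \<in> sets ?M" using tv_ball_in_sets[OF p] by (simp add: output_law_prob_space)
  have D: "dists k - ?G \<in> sets ?M" using sets.compl_sets[OF G] by (simp only: space)
  have mis: "misread k T j \<in> sets ?M" if "j < m" for j
    using misread_in_sets[of j k T] that k by (simp add: output_law_prob_space)
  have "(\<Sum>j<m. measure ?M (misread k T j)) = (\<integral>q. ?H q \<partial>?M)"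
    using mis by (subst Bochner_Integration.integral_sum) (auto simp: M.emeasure_eq_measure)
  also have "\<dots> \<le> (\<integral>q. b + real m * indicator (dists k - ?G) q \<partial>?M)"
  proof (rule integral_mono)
    show "integrable ?M ?H" using mis by (intro Bochner_Integration.integrable_sum) (auto simp: M.emeasure_eq_measure)
    show "integrable ?M (\<lambda>q. b + real m * indicator (dists k - ?G) q)"
      using D by (intro Bochner_Integration.integrable_add integrable_mult_right integrable_real_indicator)
        (auto simp: M.emeasure_eq_measure)
    fix q assume "q \<in> space ?M"
    then have q: "q \<in> dists k" by (simp add: space)
    have H: "?H q = real (card {j\<in>{..<m}. q \<in> misread k T j})"
      by (simp add: indicator_def sum.If_cases Int_def)
    have le: "card {j\<in>{..<m}. q \<in> misread k T j} \<le> m"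
      using card_mono[of "{..<m}" "{j\<in>{..<m}. q \<in> misread k T j}"] by auto
    show "?H q \<le> b + real m * indicator (dists k - ?G) q"
    proof (cases "q \<in> ?G")
      case True
      then have "s / (2 * real m) * ?H q \<le> \<epsilon>"
        using tv_dist_cube_pmf_ge[of m s k q T] m s k by auto
      then show ?thesis using True b'[OF le] H by simp
    next
      case False
      then show ?thesis using q le H b by simp
    qed
  qed
  also have "\<dots> = b + real m * (1 - measure ?M ?G)"
  proof -
    have "integrable ?M (indicat_real (dists k - ?G))"
      using D by (intro integrable_real_indicator) (auto simp: M.emeasure_eq_measure)
    moreover have "(dists k - ?G) \<inter> dists k = dists k - ?G" by blast
    ultimately show ?thesis
      using M.prob_compl[OF G] M.prob_space by (simp add: space)
  qed
  also have "\<dots> \<le> b + real m * \<delta>"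
    using learns p by (intro add_left_mono mult_left_mono) (auto simp: learns_def)
  finally show ?thesis by (simp add: mult.commute)
qed

section \<open>The two lower bounds on the sample size\<close>

lemma learner_ge_dimension:
  assumes k: "2 \<le> k" and \<epsilon>: "0 < \<epsilon>" "\<epsilon> \<le> 1 / 32" and \<delta>: "\<delta> \<le> 1 / 64"
    and learns: "learns (tv_dist k) k \<epsilon> \<delta> n A"
  shows "real k / (6144 * \<epsilon>\<^sup>2) \<le> real n"
proof -
  define m where "m = k div 2"
  \<comment> \<open>With this tilt, \<open>l\<close> misreadings cost
    \<open>8 * \<epsilon> * l / m\<close>, so accuracy \<open>\<epsilon>\<close> forces
    \<open>l \<le> m / 8\<close>.\<close>
  define s where "s = 16 * \<epsilon>"
  have m: "0 < m" "2 * m \<le> k" and "k \<le> 3 * m" using k unfolding m_def by presburger+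
  then have km: "real k \<le> 3 * real m" by linarith
  have s: "0 < s" "s \<le> 1" using \<epsilon> by (auto simp: s_def)
  have "s\<^sup>2 \<le> 1" using s by (simp add: power_le_one)
  then have le1: "s\<^sup>2 / real m \<le> 1" using m by (simp add: field_simps)
  have "(\<Sum>j<m. measure (output_law A n (cube_pmf m s T)) (misread k T j))
      \<le> real m / 8 + \<delta> * real m" for T
    using m(1) s m(2) learns
  proof (rule learner_misreads_few)
    show "real l \<le> real m / 8" if "s / (2 * real m) * real l \<le> \<epsilon>" for l
      using that m \<epsilon> by (simp add: s_def field_simps)
  qed auto
  \<comment> \<open>The error fraction is at most \<open>1 / 8 + 1 / 64 = 9 / 64\<close>; four times
    this is \<open>9 / 16\<close>, still below 1.\<close>
  moreover have "real m / 8 + \<delta> * real m \<le> 9 / 64 * real m"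
    using mult_right_mono[OF \<delta>, of "real m"] by simp
  ultimately have "(\<Sum>j<m. measure (output_law A n (cube_pmf m s T)) (misread k T j)) \<le> 9 / 64 * real m"
    for T
    by (meson order_trans)
  from assouad[OF m(1) _ _ m(2) this] have "(1 - s\<^sup>2 / real m) ^ (2 * n) \<le> 9 / 16" using s by simp
  \<comment> \<open>Bernoulli's inequality makes the power linear in \<open>n\<close>, leaving
    \<open>n * s\<^sup>2 / m\<close> at least half of \<open>7 / 16\<close>.\<close>
  moreover have "1 + real (2 * n) * - (s\<^sup>2 / real m) \<le> (1 + - (s\<^sup>2 / real m)) ^ (2 * n)"
    using le1 by (intro Bernoulli_inequality) auto
  moreover have "real (2 * n) * - (s\<^sup>2 / real m) = - (2 * (real n * s\<^sup>2 / real m))" by simp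
  ultimately have "7 / 32 \<le> real n * s\<^sup>2 / real m" unfolding diff_conv_add_uminus by argo
  then have "7 / 32 * real m \<le> real n * s\<^sup>2" using m by (simp add: le_divide_eq)
  then have "real k \<le> 24 * (real n * s\<^sup>2)" using km by simp
  then show ?thesis using \<epsilon> by (simp add: s_def power_mult_distrib field_simps)
qed

lemma learner_ge_confidence:
  assumes k: "2 \<le> k" and \<epsilon>: "0 < \<epsilon>" "\<epsilon> \<le> 1 / 32" and \<delta>: "0 < \<delta>" "\<delta> \<le> 1 / 64"
    and learns: "learns (tv_dist k) k \<epsilon> \<delta> n A"
  shows "ln (1 / \<delta>) / (2048 * \<epsilon>\<^sup>2) \<le> real n"
proof -
  define s where "s = 16 * \<epsilon>"
  have s: "0 < s" "s \<le> 1" "s \<le> 1 / 2" using \<epsilon> by (auto simp: s_def)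
  have s2: "0 \<le> s\<^sup>2" "s\<^sup>2 \<le> 1 / 2" using power_mono[OF s(3), of 2] s by (auto simp: power2_eq_square)
  have "(\<Sum>j<1. measure (output_law A n (cube_pmf 1 s T)) (misread k T j)) \<le> 0 + \<delta> * real 1" for T
    using _ s(1,2) _ learns
  proof (rule learner_misreads_few)
    \<comment> \<open>For \<open>l = 1\<close> the premise would say
      \<open>8 * \<epsilon> \<le> \<epsilon>\<close>: accurate outputs never misread a single
      pair.\<close>
    show "real l \<le> 0" if "l \<le> 1" "s / (2 * real 1) * real l \<le> \<epsilon>" for l
      using that \<epsilon> by (cases "l = 1") (auto simp: s_def)
  qed (use k in auto)
  then have "(\<Sum>j<1. measure (output_law A n (cube_pmf 1 s T)) (misread k T j)) \<le> \<delta> * real 1" for T by simp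
  from assouad[OF _ _ _ _ this] have "(1 - s\<^sup>2) ^ (2 * n) \<le> 4 * \<delta>" using s k by simp
  then have "ln ((1 - s\<^sup>2) ^ (2 * n)) \<le> ln (4 * \<delta>)"
    using s2 \<delta> by (subst ln_le_cancel_iff) auto
  then have "real (2 * n) * ln (1 - s\<^sup>2) \<le> ln (4 * \<delta>)"
    using s2 by (simp add: ln_realpow)
  \<comment> \<open>The bound on the logarithm requires \<open>s\<^sup>2 \<le> 1 / 2\<close>, which
    \<open>\<epsilon> \<le> 1 / 32\<close> ensures.\<close>
  moreover have "- 2 * s\<^sup>2 \<le> ln (1 - s\<^sup>2)"
  proof -
    have "- s\<^sup>2 - 2 * (s\<^sup>2)\<^sup>2 \<le> ln (1 - s\<^sup>2)" using s2 by (intro ln_one_minus_pos_lower_bound) auto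
    moreover have "2 * (s\<^sup>2)\<^sup>2 \<le> s\<^sup>2" unfolding power2_eq_square[of "s\<^sup>2"]
      using mult_right_mono[OF s2(2) s2(1)] by simp
    ultimately show ?thesis by simp
  qed
  then have "real (2 * n) * (- 2 * s\<^sup>2) \<le> real (2 * n) * ln (1 - s\<^sup>2)" by (intro mult_left_mono) auto
  \<comment> \<open>The factor 4 is absorbed by squaring:
    \<open>16 * \<delta>\<^sup>2 \<le> \<delta>\<close> for small \<open>\<delta>\<close>.\<close>
  moreover have "2 * ln (4 * \<delta>) \<le> ln \<delta>"
  proof -
    have "2 * ln (4 * \<delta>) = ln ((4 * \<delta>)\<^sup>2)" using \<delta> by (subst ln_realpow) auto
    also have "\<dots> \<le> ln \<delta>"
      using \<delta> by (subst ln_le_cancel_iff) (auto simp: power2_eq_square)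
    finally show ?thesis .
  qed
  ultimately have "- ln \<delta> \<le> 8 * (real n * s\<^sup>2)" by simp
  then have "ln (1 / \<delta>) \<le> 8 * (real n * s\<^sup>2)" using \<delta> by (simp add: ln_div)
  then show ?thesis using \<epsilon> by (simp add: s_def power_mult_distrib field_simps)
qed

end

section \<open>Combining the bounds\<close>

lemma sample_complexity_lower:
  assumes k: "2 \<le> k" and \<epsilon>: "0 < \<epsilon>" "\<epsilon> \<le> 1 / 32" and \<delta>: "0 < \<delta>" "\<delta> \<le> 1 / 64"
  shows "ereal (1 / 12288 * ((real k + ln (1 / \<delta>)) / \<epsilon>\<^sup>2))
           \<le> ereal_of_enat (sample_complexity (tv_dist k) k \<epsilon> \<delta>)"
proof (cases "sample_complexity (tv_dist k) k \<epsilon> \<delta>")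
  case (enat n)
  let ?X = "{enat n | n. \<exists>A\<in>rand_estimators k. learns (tv_dist k) k \<epsilon> \<delta> n A}"
  \<comment> \<open>A finite complexity is the infimum of a nonempty set, hence attained by an
    actual learner; an infinite one satisfies the bound trivially.\<close>
  have "?X \<noteq> {}" "Inf ?X = enat n"
    using enat unfolding sample_complexity_def by (auto simp: Inf_enat_def split: if_splits)
  then have "enat n \<in> ?X"
    by (metis (mono_tags, lifting) Inf_enat_def LeastI_ex ex_in_conv)
  then obtain A where A: "A \<in> rand_estimators k" and learns: "learns (tv_dist k) k \<epsilon> \<delta> n A"
    by auto
  have L: "0 \<le> ln (1 / \<delta>)" using \<delta> by simp
  have "ln (1 / \<delta>) / (6144 * \<epsilon>\<^sup>2) \<le> ln (1 / \<delta>) / (2048 * \<epsilon>\<^sup>2)"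
    using L \<epsilon> by (intro divide_left_mono) auto
  also have "\<dots> \<le> real n" by (rule learner_ge_confidence[OF A k \<epsilon> \<delta> learns])
  finally have "ln (1 / \<delta>) / (6144 * \<epsilon>\<^sup>2) \<le> real n" .
  moreover have "real k / (6144 * \<epsilon>\<^sup>2) \<le> real n"
    by (rule learner_ge_dimension[OF A k \<epsilon> \<delta>(2) learns])
  \<comment> \<open>The average of the two lower bounds, after both are brought to the denominator
    \<open>6144 * \<epsilon>\<^sup>2\<close>.\<close>
  moreover have "1 / 12288 * ((real k + ln (1 / \<delta>)) / \<epsilon>\<^sup>2)
      = (real k / (6144 * \<epsilon>\<^sup>2) + ln (1 / \<delta>) / (6144 * \<epsilon>\<^sup>2)) / 2"
    by (simp flip: add_divide_distrib)
  moreover have "(x + y) / 2 \<le> z" if "x \<le> z" "y \<le> z" for x y z :: real using that by simp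
  ultimately have "1 / 12288 * ((real k + ln (1 / \<delta>)) / \<epsilon>\<^sup>2) \<le> real n" by presburger
  then show ?thesis using enat by simp
qed simp

theorem theorem1:
  shows "\<exists>(c::real) (C::real) (k0::nat) (\<epsilon>0::real) (\<delta>0::real).
    0 < c \<and> c \<le> C \<and> 0 < \<epsilon>0 \<and> 0 < \<delta>0 \<and>
    (\<forall>(k::nat) (\<epsilon>::real) (\<delta>::real).
       k0 \<le> k \<and> 0 < \<epsilon> \<and> \<epsilon> \<le> \<epsilon>0 \<and> 0 < \<delta> \<and> \<delta> \<le> \<delta>0 \<longrightarrow>
       ereal (c * ((real k + ln (1 / \<delta>)) / \<epsilon>\<^sup>2))
         \<le> ereal_of_enat (sample_complexity (tv_dist k) k \<epsilon> \<delta>) \<and>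
       ereal_of_enat (sample_complexity (tv_dist k) k \<epsilon> \<delta>)
         \<le> ereal (C * ((real k + ln (1 / \<delta>)) / \<epsilon>\<^sup>2)))"
proof -
  have "ereal (1 / 12288 * ((real k + ln (1 / \<delta>)) / \<epsilon>\<^sup>2))
          \<le> ereal_of_enat (sample_complexity (tv_dist k) k \<epsilon> \<delta>) \<and>
        ereal_of_enat (sample_complexity (tv_dist k) k \<epsilon> \<delta>)
          \<le> ereal (2 * ((real k + ln (1 / \<delta>)) / \<epsilon>\<^sup>2))"
    if "2 \<le> k" "0 < \<epsilon>" "\<epsilon> \<le> 1 / 32" "0 < \<delta>" "\<delta> \<le> 1 / 64" for k \<epsilon> \<delta>
    using that sample_complexity_lower[of k \<epsilon> \<delta>] sample_complexity_upper[of k \<epsilon> \<delta>] by simp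
  then show ?thesis
    by (intro exI[of _ "1 / 12288"] exI[of _ 2] exI[of _ "2 :: nat"] exI[of _ "1 / 32"] exI[of _ "1 / 64"])
       (simp del: One_nat_def)
qed

end
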